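(* Let $h \in \mathbb{H}$ and let $K$ be a fundamental domain for $\mathbb{H}(\mathbb{Z})$ with $\operatorname{rad}(K)<1$. Then $\mathbb K CF(h)=h$. Furthermore, if $CF(h)=\{\gamma_i\}$ is a sequence with at least $n$ terms, then the rational approximants satisfy $d\left(\mathbb K \{\gamma_i\}_{i=0}^n, h\right) \leq \operatorname{rad}(K)^{n+1}$ for both rational and irrational points in $\mathbb{H}$. Let $q_n$ be the denominator of the $n^{th}$ rational approximant. Then in fact $d\left(\mathbb K \{\gamma_i\}_{i=0}^n, h\right) \leq \frac{\operatorname{rad}(K)^{n+1}}{|q_n|^{1/2}}$.
   Context: The Heisenberg group $\mathbb H=\mathbb C\times\mathbb R$ with law $(z,t)*(z',t')=(z+z',t+t'+2\operatorname{Im}(\overline z z'))$, gauge norm $\|(z,t)\|=\sqrt[4]{|z|^4+t^2}$, metric $d(h,k)=\|h^{-1}*k\|$; $\mathbb H(\mathbb Z)=\mathbb Z[i]\times\mathbb Z$. A fundamental domain $K$ is a connected set with piecewise smooth boundary whose $\mathbb H(\mathbb Z)$-left-translates tile $\mathbb H$ without overlap; $\operatorname{rad}(K)=\sup_{k\in K}\|k\|$. With $[h]=g$ iff $h\in g*K$ and Koranyi inversion $\iota(z,t)=\left(\frac{-z}{|z|^2+it},\frac{-t}{|z|^4+t^2}\right)$, the digits $CF(h)=\{\gamma_i\}$ are $\gamma_0=[h]$, $h_0=\gamma_0^{-1}*h$, $\gamma_{i+1}=[\iota h_i]$, $h_{i+1}=\gamma_{i+1}^{-1}*\iota h_i$.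 $\mathbb K\{\gamma_i\}_{i=0}^n=\gamma_0\iota\gamma_1\iota\cdots\iota\gamma_n$ (composition applied to the identity), and $\mathbb K$ of an infinite sequence is the limit of these. The rational approximant $\mathbb K\{\gamma_i\}_{i=1}^n$ has planar Siegel coordinates $(r_n/q_n,p_n/q_n)$, where a point $(z,t)$ has planar Siegel coordinates $(z(1+i),|z|^2+it)$, and $(q_n,r_n,p_n)^T=A_{\gamma_1}\cdots A_{\gamma_n}(1,0,0)^T$ with $A_\gamma=\begin{pmatrix}-\beta&-\overline\alpha&-1\\ \alpha&1&0\\ -1&0&0\end{pmatrix}$ for $\gamma$ with planar Siegel coordinates $(\alpha,\beta)$. *)

theory Defs
  imports "HOL-Analysis.Analysis"
begin

(* The product topology of complex \<times> real agrees with the topology of hdist below, so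
   connectedness and frontiers are those of the type; the type's own addition and
   distance are Euclidean and are not the Heisenberg operations. *)
type_synonym heis = "complex \<times> real"

definition hmul :: "heis \<Rightarrow> heis \<Rightarrow> heis" where
  "hmul h k = (fst h + fst k, snd h + snd k + 2 * Im (cnj (fst h) * fst k))"

definition hone :: heis where
  "hone = (0, 0)"

definition hinv :: "heis \<Rightarrow> heis" where
  "hinv h = (- fst h, - snd h)"

definition hnorm :: "heis \<Rightarrow> real" where
  "hnorm h = root 4 (cmod (fst h) ^ 4 + (snd h)\<^sup>2)"

definition hdist :: "heis \<Rightarrow> heis \<Rightarrow> real" where
  "hdist h k = hnorm (hmul (hinv h) k)"

definition heisZ :: "heis set" where
  "heisZ = {h. Re (fst h) \<in> \<int> \<and> Im (fst h) \<in> \<int> \<and> snd h \<in> \<int>}"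

(* Undefined at the identity in the mathematics; here the value there is the identity. *)
definition koranyi :: "heis \<Rightarrow> heis" where
  "koranyi h =
     (- fst h / (complex_of_real ((cmod (fst h))\<^sup>2) + \<i> * complex_of_real (snd h)),
      - snd h / (cmod (fst h) ^ 4 + (snd h)\<^sup>2))"

(* The supremum is taken in the extended reals, so that rad K < 1 entails boundedness. *)
definition rad :: "heis set \<Rightarrow> ereal" where
  "rad K = (SUP k\<in>K. ereal (hnorm k))"

(* A closed square mapped C1 on a neighbourhood, regular and injective on the open
   square. As usual for surface patches, edges may be collapsed or identified. *)
definition C1_patch :: "heis set \<Rightarrow> bool" where
  "C1_patch S \<longleftrightarrow>
     (\<exists>(\<phi> :: real \<times> real \<Rightarrow> heis) (\<phi>' :: real \<times> real \<Rightarrow> (real \<times> real) \<Rightarrow>\<^sub>L heis) U.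
        open U \<and> cbox (0, 0) (1, 1) \<subseteq> U
        \<and> (\<forall>x\<in>U. (\<phi> has_derivative blinfun_apply (\<phi>' x)) (at x))
        \<and> continuous_on U \<phi>'
        \<and> inj_on \<phi> (box (0, 0) (1, 1))
        \<and> (\<forall>x\<in>box (0, 0) (1, 1). inj (blinfun_apply (\<phi>' x)))
        \<and> S = \<phi> ` cbox (0, 0) (1, 1))"

(* "Smooth" is read as C1, the weakest usual meaning; the family of patches is locally
   finite, hence finite when K is bounded. *)
definition piecewise_smooth_boundary :: "heis set \<Rightarrow> bool" where
  "piecewise_smooth_boundary K \<longleftrightarrow>
     (\<exists>\<P>. (\<forall>S\<in>\<P>. C1_patch S)
        \<and> (\<forall>x. \<exists>e>0. finite {S \<in> \<P>. S \<inter> ball x e \<noteq> {}})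
        \<and> frontier K = \<Union>\<P>)"

(* Tiling without overlap: every point lies in exactly one translate. This is what
   makes hfloor a function. *)
definition fundamental_domain :: "heis set \<Rightarrow> bool" where
  "fundamental_domain K \<longleftrightarrow>
     connected K \<and> piecewise_smooth_boundary K
     \<and> (\<forall>h. \<exists>!g. g \<in> heisZ \<and> h \<in> hmul g ` K)"

definition hfloor :: "heis set \<Rightarrow> heis \<Rightarrow> heis" where
  "hfloor K h = (THE g. g \<in> heisZ \<and> h \<in> hmul g ` K)"

(* The remainders h_i. The expansion stops (None) after a remainder equal to the
   identity, at which the inversion is not defined. *)
primrec cf_rem :: "heis set \<Rightarrow> heis \<Rightarrow> nat \<Rightarrow> heis option" where
  "cf_rem K h 0 = Some (hmul (hinv (hfloor K h)) h)"
| "cf_rem K h (Suc i) =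
     (case cf_rem K h i of
        None \<Rightarrow> None
      | Some x \<Rightarrow> if x = hone then None
                 else Some (hmul (hinv (hfloor K (koranyi x))) (koranyi x)))"

(* The digit sequence of h; a finite sequence is followed by None forever. *)
fun CF :: "heis set \<Rightarrow> heis \<Rightarrow> nat \<Rightarrow> heis option" where
  "CF K h 0 = Some (hfloor K h)"
| "CF K h (Suc i) =
     (case cf_rem K h i of
        None \<Rightarrow> None
      | Some x \<Rightarrow> if x = hone then None else Some (hfloor K (koranyi x)))"

fun cfrac :: "heis list \<Rightarrow> heis" where
  "cfrac [] = hone"
| "cfrac [\<gamma>] = hmul \<gamma> hone"
| "cfrac (\<gamma> # \<gamma>' # \<gamma>s) = hmul \<gamma> (koranyi (cfrac (\<gamma>' # \<gamma>s)))"

definition approximant :: "(nat \<Rightarrow> heis option) \<Rightarrow> nat \<Rightarrow> heis" where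
  "approximant \<gamma> n = cfrac (map (\<lambda>i. the (\<gamma> i)) [0..<Suc n])"

(* The continued fraction with digits \<gamma> has value x: the last approximant if \<gamma> is
   finite, and otherwise the limit of the approximants in the metric hdist. *)
definition has_cf_value :: "(nat \<Rightarrow> heis option) \<Rightarrow> heis \<Rightarrow> bool" where
  "has_cf_value \<gamma> x \<longleftrightarrow>
     (if \<forall>n. \<gamma> n \<noteq> None
      then (\<lambda>n. hdist (approximant \<gamma> n) x) \<longlonglongrightarrow> 0
      else \<exists>n. (\<forall>i\<le>n. \<gamma> i \<noteq> None) \<and> \<gamma> (Suc n) = None \<and> approximant \<gamma> n = x)"

definition siegel :: "heis \<Rightarrow> complex \<times> complex" where
  "siegel h = (fst h * (1 + \<i>),
               complex_of_real ((cmod (fst h))\<^sup>2) + \<i> * complex_of_real (snd h))"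

definition A_mat :: "heis \<Rightarrow> complex ^ 3 ^ 3" where
  "A_mat \<gamma> = (let (\<alpha>, \<beta>) = siegel \<gamma> in
     vector [vector [- \<beta>, - cnj \<alpha>, - 1],
             vector [\<alpha>, 1, 0],
             vector [- 1, 0, 0]])"

(* The vector (q_n, r_n, p_n). As A_mat represents the inversion composed with the
   translation by its argument, this gives the point with the inversion applied before
   the first digit as well, and the digit with index 0 does not enter. *)
definition qrp :: "(nat \<Rightarrow> heis option) \<Rightarrow> nat \<Rightarrow> complex ^ 3" where
  "qrp \<gamma> n =
     foldr (\<lambda>g M. A_mat g ** M) (map (\<lambda>i. the (\<gamma> i)) [1..<Suc n]) (mat 1)
       *v vector [1, 0, 0]"

definition q_denom :: "(nat \<Rightarrow> heis option) \<Rightarrow> nat \<Rightarrow> complex" where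
  "q_denom \<gamma> n = qrp \<gamma> n $ 1"

end

theory Submission
  imports Defs
begin

text \<open>
  Write \<open>\<beta> h = |z|\<^sup>2 + \<i>t\<close> for the second Siegel coordinate, so that the gauge norm is
  \<open>sqrt |\<beta> h|\<close> and the inversion sends \<open>\<beta>\<close> to \<open>1 / \<beta>\<close> and divides distances by the product of the
  two norms. Pulling \<open>\<gamma>\<^sub>n\<close>, \<dots>, \<open>\<gamma>\<^sub>0\<close> back through the expansion gives the exact formula
  \<open>d (K{\<gamma>\<^sub>0, \<dots>, \<gamma>\<^sub>n}, h) = \<Prod>\<^sub>i \<parallel>h\<^sub>i\<parallel> / \<Prod>\<^sub>i \<parallel>a\<^sub>i\<parallel>\<close>, where the \<open>a\<^sub>i\<close> (\<open>i \<ge> 1\<close>) are the approximants of the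
  tails of the expansion, and the matrix recursion identifies the second product with
  \<open>sqrt |q\<^sub>n|\<close>. No \<open>a\<^sub>i\<close> is the identity: the denominators are Gaussian integers, so a nonzero one has
  modulus at least \<open>1\<close> and the formula for the tail puts \<open>a\<^sub>i\<close> within distance \<open>1\<close> of a
  point of norm more than \<open>1\<close>.
\<close>

section \<open>The Heisenberg group and the inversion\<close>

definition hbeta :: "heis \<Rightarrow> complex" where
  "hbeta h = complex_of_real ((cmod (fst h))\<^sup>2) + \<i> * complex_of_real (snd h)"

lemma siegel_eq: "siegel h = (fst h * (1 + \<i>), hbeta h)"
  by (simp add: siegel_def hbeta_def)

lemma Re_hbeta [simp]: "Re (hbeta h) = (cmod (fst h))\<^sup>2"
  and Im_hbeta [simp]: "Im (hbeta h) = snd h"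
  by (simp_all add: hbeta_def)

lemma heis_eqI: "fst h = fst k \<Longrightarrow> hbeta h = hbeta k \<Longrightarrow> h = k"
  by (metis Im_hbeta prod_eqI)

lemma hbeta_eq_0_iff [simp]: "hbeta h = 0 \<longleftrightarrow> h = hone"
  by (auto simp: complex_eq_iff hone_def prod_eq_iff)

lemma cmod_hbeta: "cmod (hbeta h) = sqrt (cmod (fst h) ^ 4 + (snd h)\<^sup>2)"
  unfolding cmod_def[of "hbeta h"] by simp

lemma hnorm_eq: "hnorm h = sqrt (cmod (hbeta h))"
proof -
  have "root (2 * 2) x = sqrt (sqrt x)" for x
    unfolding sqrt_def by (rule real_root_mult_exp)
  then show ?thesis
    by (simp add: hnorm_def cmod_hbeta)
qed

lemma hnorm_nonneg [simp]: "0 \<le> hnorm h"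
  by (simp add: hnorm_eq)

lemma hnorm_eq_0_iff [simp]: "hnorm h = 0 \<longleftrightarrow> h = hone"
  by (simp add: hnorm_eq)

lemma hmul_assoc: "hmul (hmul a b) c = hmul a (hmul b c)"
  by (simp add: hmul_def algebra_simps)

lemma hmul_hone [simp]: "hmul h hone = h" "hmul hone h = h"
  by (simp_all add: hmul_def hone_def)

lemma hmul_hinv [simp]: "hmul h (hinv h) = hone" "hmul (hinv h) h = hone"
  by (simp_all add: hmul_def hinv_def hone_def algebra_simps)

lemma hmul_hinv_cancel [simp]:
  "hmul g (hmul (hinv g) h) = h" "hmul (hinv g) (hmul g h) = h"
  by (simp_all flip: hmul_assoc)

lemma hinv_hmul: "hinv (hmul a b) = hmul (hinv b) (hinv a)"
  by (simp add: hmul_def hinv_def algebra_simps)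

lemma hinv_hone [simp]: "hinv hone = hone"
  by (simp add: hinv_def hone_def)

lemma hdist_nonneg [simp]: "0 \<le> hdist h k"
  by (simp add: hdist_def)

lemma hdist_eq_0_iff [simp]: "hdist h k = 0 \<longleftrightarrow> h = k"
  by (metis hdist_def hmul_hinv(2) hmul_hinv_cancel(1) hmul_hone(1) hnorm_eq_0_iff)

lemma hdist_hmul [simp]: "hdist (hmul g h) (hmul g k) = hdist h k"
  by (simp add: hdist_def hinv_hmul hmul_assoc)

lemma hdist_hone [simp]: "hdist hone h = hnorm h"
  by (simp add: hdist_def)

text \<open>The real part of the cross term \<open>2 * cnj (fst h) * fst k\<close> completes |z +
  z'|^2; its imaginary part is the twist in the group law.\<close>

lemma hbeta_hmul: "hbeta (hmul h k) = hbeta h + hbeta k + 2 * cnj (fst h) * fst k"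
  by (simp add: complex_eq_iff hmul_def cmod_power2) (simp add: power2_eq_square algebra_simps)

lemma hbeta_hinv: "hbeta (hinv h) = cnj (hbeta h)"
  by (simp add: complex_eq_iff hinv_def)

lemma fst_koranyi: "fst (koranyi h) = - fst h / hbeta h"
  by (simp add: koranyi_def hbeta_def)

text \<open>The coordinates of \<open>koranyi h\<close> combine to the conjugate of
  \<open>hbeta h\<close> over its squared modulus. At the identity both sides are 0, as division by
  0 gives 0.\<close>

lemma hbeta_koranyi: "hbeta (koranyi h) = 1 / hbeta h"
proof -
  have "(cmod (hbeta h))\<^sup>2 = cmod (fst h) ^ 4 + (snd h)\<^sup>2"
    by (simp add: cmod_hbeta)
  then have "snd (koranyi h) = - snd h / (cmod (hbeta h))\<^sup>2"
    by (simp add: koranyi_def)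
  then show ?thesis
    by (simp add: complex_eq_iff fst_koranyi norm_divide power_divide Re_divide' Im_divide')
qed

lemma koranyi_koranyi: "h \<noteq> hone \<Longrightarrow> koranyi (koranyi h) = h"
  by (rule heis_eqI) (simp_all add: fst_koranyi hbeta_koranyi)

lemma hnorm_koranyi: "hnorm (koranyi h) = 1 / hnorm h"
  by (simp add: hnorm_eq hbeta_koranyi norm_divide real_sqrt_divide)

text \<open>The squared distance is the modulus of a form in which inversion swaps the first two
  terms, up to the common divisor \<open>cnj (hbeta h) * hbeta k\<close>.\<close>

lemma hdist_koranyi:
  assumes "h \<noteq> hone" "k \<noteq> hone"
  shows "hdist (koranyi h) (koranyi k) = hdist h k / (hnorm h * hnorm k)"
proof -
  have dist_hbeta: "hdist h k = sqrt (cmod (cnj (hbeta h) + hbeta k - 2 * cnj (fst h) * fst k))" for h k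
    by (simp add: hdist_def hnorm_eq hbeta_hmul hbeta_hinv) (simp add: hinv_def)
  have "cnj (hbeta (koranyi h)) + hbeta (koranyi k) - 2 * cnj (fst (koranyi h)) * fst (koranyi k)
      = (cnj (hbeta h) + hbeta k - 2 * cnj (fst h) * fst k) / (cnj (hbeta h) * hbeta k)"
    using assms by (simp add: hbeta_koranyi fst_koranyi field_simps)
  then show ?thesis
    by (simp add: dist_hbeta hnorm_eq norm_divide norm_mult real_sqrt_divide real_sqrt_mult)
qed

section \<open>Gaussian integers\<close>

definition gaussian_ints :: "complex set" where
  "gaussian_ints = {z. Re z \<in> \<int> \<and> Im z \<in> \<int>}"

lemma gaussian_ints_closed:
  "0 \<in> gaussian_ints" "1 \<in> gaussian_ints" "\<i> \<in> gaussian_ints"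
  "a \<in> gaussian_ints \<Longrightarrow> - a \<in> gaussian_ints"
  "a \<in> gaussian_ints \<Longrightarrow> cnj a \<in> gaussian_ints"
  "a \<in> gaussian_ints \<Longrightarrow> b \<in> gaussian_ints \<Longrightarrow> a + b \<in> gaussian_ints"
  "a \<in> gaussian_ints \<Longrightarrow> b \<in> gaussian_ints \<Longrightarrow> a - b \<in> gaussian_ints"
  "a \<in> gaussian_ints \<Longrightarrow> b \<in> gaussian_ints \<Longrightarrow> a * b \<in> gaussian_ints"
  by (simp_all add: gaussian_ints_def)

lemma gaussian_ints_cmod_ge_1:
  assumes "z \<in> gaussian_ints" "z \<noteq> 0"
  shows "1 \<le> cmod z"
proof -
  have "1 \<le> \<bar>Re z\<bar> \<or> 1 \<le> \<bar>Im z\<bar>"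
    using assms by (auto simp: gaussian_ints_def complex_eq_iff intro: Ints_nonzero_abs_ge1)
  then show ?thesis
    using abs_Re_le_cmod[of z] abs_Im_le_cmod[of z] by linarith
qed

lemma hbeta_in_gaussian_ints: "g \<in> heisZ \<Longrightarrow> hbeta g \<in> gaussian_ints"
  by (simp add: gaussian_ints_def heisZ_def cmod_power2)

lemma fst_in_gaussian_ints: "g \<in> heisZ \<Longrightarrow> fst g \<in> gaussian_ints"
  by (simp add: gaussian_ints_def heisZ_def)

section \<open>Approximants and their denominators\<close>

text \<open>The continued fraction with the inversion applied before the first digit as well, which is
  the point that the matrices represent.\<close>

definition inv_cfrac :: "heis list \<Rightarrow> heis" where
  "inv_cfrac gs = foldr (\<lambda>g y. koranyi (hmul g y)) gs hone"

lemma inv_cfrac_simps [simp]: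
  "inv_cfrac [] = hone" "inv_cfrac (g # gs) = koranyi (hmul g (inv_cfrac gs))"
  by (simp_all add: inv_cfrac_def)

lemma cfrac_Cons: "cfrac (g # gs) = hmul g (inv_cfrac gs)"
  by (induction gs arbitrary: g) simp_all

text \<open>The vector (q, r, p) of a digit list, with the matrices applied one at a time so that
  prepending a digit is a single multiplication.\<close>

definition cf_vec :: "heis list \<Rightarrow> complex ^ 3" where
  "cf_vec gs = foldr (\<lambda>g v. A_mat g *v v) gs (vector [1, 0, 0])"

lemma cf_vec_simps [simp]:
  "cf_vec [] = vector [1, 0, 0]" "cf_vec (g # gs) = A_mat g *v cf_vec gs"
  by (simp_all add: cf_vec_def)

lemma foldr_A_mat: "foldr (\<lambda>g M. A_mat g ** M) gs (mat 1) *v vector [1, 0, 0] = cf_vec gs"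
  by (induction gs) (simp_all flip: matrix_vector_mul_assoc)

lemma A_mat_mult:
  "(A_mat g *v v) $ 1 = - hbeta g * v $ 1 - cnj (fst g * (1 + \<i>)) * v $ 2 - v $ 3"
  "(A_mat g *v v) $ 2 = fst g * (1 + \<i>) * v $ 1 + v $ 2"
  "(A_mat g *v v) $ 3 = - v $ 1"
  by (simp_all add: A_mat_def siegel_eq matrix_vector_mult_def sum_3)

lemma cf_vec_gaussian_ints:
  assumes "set gs \<subseteq> heisZ"
  shows "cf_vec gs $ 1 \<in> gaussian_ints" "cf_vec gs $ 2 \<in> gaussian_ints" "cf_vec gs $ 3 \<in> gaussian_ints"
  using assms
  by (induction gs)
    (auto simp: A_mat_mult simp del: complex_cnj_mult
      intro!: gaussian_ints_closed hbeta_in_gaussian_ints fst_in_gaussian_ints)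

text \<open>Homogeneous coordinates: dividing \<open>v\<close> by its first entry gives (1, r/q,
  p/q), the last two being the planar Siegel coordinates of \<open>y\<close>.\<close>

definition represents :: "complex ^ 3 \<Rightarrow> heis \<Rightarrow> bool" where
  "represents v y \<longleftrightarrow> v $ 1 \<noteq> 0 \<and> v $ 2 = v $ 1 * fst (siegel y) \<and> v $ 3 = v $ 1 * snd (siegel y)"

text \<open>The first row reproduces \<open>hbeta_hmul\<close>, so a step multiplies |q| by the
  squared norm of \<open>hmul g y\<close>. Dividing the other rows by the new q gives the inverted
  point.\<close>

lemma A_mat_represents:
  assumes "represents v y"
  shows "(A_mat g *v v) $ 1 = - v $ 1 * hbeta (hmul g y)"
    and "hmul g y \<noteq> hone \<Longrightarrow> represents (A_mat g *v v) (koranyi (hmul g y))"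
proof -
  \<comment> \<open>The Siegel scaling 1 + i has squared modulus 2, the coefficient of the cross
    term in \<open>hbeta_hmul\<close>.\<close>
  have "cnj (1 + \<i>) * (1 + \<i>) = 2"
    by (simp add: complex_eq_iff)
  then have *: "cnj (fst g * (1 + \<i>)) * (fst y * (1 + \<i>)) = 2 * cnj (fst g) * fst y"
    by (metis (no_types, lifting) complex_cnj_mult mult.assoc mult.commute)
  have "cnj (fst g * (1 + \<i>)) * v $ 2 = v $ 1 * (2 * cnj (fst g) * fst y)"
    using assms unfolding represents_def siegel_eq * [symmetric] by simp
  then show 1: "(A_mat g *v v) $ 1 = - v $ 1 * hbeta (hmul g y)"
    using assms unfolding A_mat_mult represents_def
    by (simp add: hbeta_hmul siegel_eq algebra_simps del: complex_cnj_mult)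
  assume "hmul g y \<noteq> hone"
  moreover have "fst (hmul g y) = fst g + fst y"
    by (simp add: hmul_def)
  ultimately show "represents (A_mat g *v v) (koranyi (hmul g y))"
    using assms unfolding represents_def 1
    by (simp add: A_mat_mult siegel_eq fst_koranyi hbeta_koranyi field_simps)
qed

text \<open>Here \<open>gs i\<close> lists the digits i+1 to n, so \<open>inv_cfrac (gs i)\<close>
  approximates the remainder \<open>x i\<close>. Going down in i, the norm of the new approximant
  before inversion cancels between distance and denominator, leaving one factor
  \<open>hnorm (x i)\<close>. The two claims are proved together because the integrality bound on q
  rules out inverting the identity.\<close>

lemma inv_cfrac_error:
  fixes g x :: "nat \<Rightarrow> heis"
  assumes "i \<le> n"
    and digits: "\<And>j. g j \<in> heisZ"
    and small: "\<And>j. j \<le> n \<Longrightarrow> hnorm (x j) < 1"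
    and nonzero: "\<And>j. j < n \<Longrightarrow> x j \<noteq> hone"
    and step: "\<And>j. j < n \<Longrightarrow> koranyi (x j) = hmul (g (Suc j)) (x (Suc j))"
  defines "gs \<equiv> \<lambda>i. map g [Suc i..<Suc n]"
  shows "represents (cf_vec (gs i)) (inv_cfrac (gs i)) \<and>
    hdist (inv_cfrac (gs i)) (x i) * sqrt (cmod (cf_vec (gs i) $ 1)) = (\<Prod>j=i..n. hnorm (x j))"
  using \<open>i \<le> n\<close>
proof (induction rule: inc_induct)
  case base
  \<comment> \<open>No digits remain: the approximant is the identity, q is 1, and the distance is
    the norm of the last remainder.\<close>
  show ?case
    by (simp add: gs_def represents_def siegel_eq) (simp add: hone_def)
next
  case (step i)
  let ?q = "cf_vec (gs (Suc i)) $ 1"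
  define y where "y = inv_cfrac (gs (Suc i))"
  define a where "a = hmul (g (Suc i)) y"
  have gs: "gs i = g (Suc i) # gs (Suc i)"
    using \<open>i < n\<close> unfolding gs_def by (subst upt_conv_Cons) auto
  have q: "represents (cf_vec (gs (Suc i))) y"
    and error: "hdist y (x (Suc i)) * sqrt (cmod ?q) = (\<Prod>j=Suc i..n. hnorm (x j))"
    using step.IH by (simp_all add: y_def)
  have "set (gs (Suc i)) \<subseteq> heisZ"
    using digits by (auto simp: gs_def)
  then have q1: "1 \<le> cmod ?q"
    using q by (intro gaussian_ints_cmod_ge_1 cf_vec_gaussian_ints) (simp_all add: represents_def)
  have x: "x i \<noteq> hone" "koranyi (x i) = hmul (g (Suc i)) (x (Suc i))"
    using \<open>i < n\<close> nonzero assms(5) by auto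
  have dist_a: "hdist a (koranyi (x i)) = hdist y (x (Suc i))"
    by (simp add: a_def x)
  have "a \<noteq> hone"
  proof
    assume "a = hone"
    then have "1 / hnorm (x i) = hdist y (x (Suc i))"
      using dist_a by (simp add: hnorm_koranyi)
    also have "\<dots> \<le> hdist y (x (Suc i)) * sqrt (cmod ?q)"
      using q1 mult_left_mono[of 1 "sqrt (cmod ?q)" "hdist y (x (Suc i))"] by simp
    also have "\<dots> \<le> 1"
      unfolding error using small by (intro prod_le_1) (auto simp: less_imp_le)
    finally have "1 \<le> hnorm (x i)"
      using x(1) by (simp add: field_simps order_less_le)
    then show False
      using small[of i] \<open>i < n\<close> by simp
  qed
  have kx: "koranyi (x i) \<noteq> hone"
    using x(1) hnorm_koranyi[of "x i"] by (metis divide_eq_0_iff hnorm_eq_0_iff zero_neq_one)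
  have "hdist (koranyi a) (x i) = hdist (koranyi a) (koranyi (koranyi (x i)))"
    using x(1) by (simp add: koranyi_koranyi)
  also have "\<dots> = hdist y (x (Suc i)) * hnorm (x i) / hnorm a"
    using \<open>a \<noteq> hone\<close> kx by (simp add: hdist_koranyi dist_a hnorm_koranyi)
  finally have "hdist (koranyi a) (x i) * hnorm a = hdist y (x (Suc i)) * hnorm (x i)"
    using \<open>a \<noteq> hone\<close> by simp
  moreover have "sqrt (cmod (cf_vec (gs i) $ 1)) = sqrt (cmod ?q) * hnorm a"
    using A_mat_represents(1)[OF q] by (simp add: gs a_def hnorm_eq norm_mult real_sqrt_mult)
  ultimately have "hdist (koranyi a) (x i) * sqrt (cmod (cf_vec (gs i) $ 1))
      = (hdist y (x (Suc i)) * sqrt (cmod ?q)) * hnorm (x i)"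
    by (simp add: mult_ac)
  also have "\<dots> = (\<Prod>j=i..n. hnorm (x j))"
    unfolding error using \<open>i < n\<close> by (subst prod.atLeast_Suc_atMost[of i]) simp_all
  finally show ?case
    using A_mat_represents(2)[OF q] \<open>a \<noteq> hone\<close> by (simp add: gs a_def flip: y_def)
qed

section \<open>The expansion of a point\<close>

lemma hfloor:
  assumes "fundamental_domain K"
  shows "hfloor K h \<in> heisZ" "hmul (hinv (hfloor K h)) h \<in> K"
proof -
  have "\<exists>!g. g \<in> heisZ \<and> h \<in> hmul g ` K"
    using assms unfolding fundamental_domain_def by blast
  from theI'[OF this] have "hfloor K h \<in> heisZ \<and> h \<in> hmul (hfloor K h) ` K"
    unfolding hfloor_def .
  then show "hfloor K h \<in> heisZ" "hmul (hinv (hfloor K h)) h \<in> K"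
    by (metis imageE hmul_hinv_cancel(2))+
qed

text \<open>\<open>K\<close> contains the remainder of any point, so the supremum is over a nonempty
  set and lies in [0, 1).\<close>

lemma rad_real:
  assumes "fundamental_domain K" "rad K < 1"
  obtains r where "rad K = ereal r" "0 \<le> r" "r < 1" "\<And>k. k \<in> K \<Longrightarrow> hnorm k \<le> r"
proof -
  have le: "ereal (hnorm k) \<le> rad K" if "k \<in> K" for k
    unfolding rad_def using that by (rule SUP_upper)
  moreover obtain k where "k \<in> K"
    using hfloor(2)[OF assms(1)] by blast
  ultimately have "0 \<le> rad K"
    by (meson ereal_less_eq(5) hnorm_nonneg order_trans)
  with assms(2) obtain r where "rad K = ereal r"
    by (cases "rad K") auto
  with that le assms(2) \<open>0 \<le> rad K\<close> show thesis
    by (simp add: one_ereal_def)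
qed

lemma CF_eq_None_iff: "CF K h n = None \<longleftrightarrow> cf_rem K h n = None"
  by (cases n) (auto split: option.splits)

lemma CF_not_None_antimono:
  assumes "CF K h n \<noteq> None" "i \<le> n"
  shows "CF K h i \<noteq> None"
  using assms(2,1) unfolding CF_eq_None_iff
  by (induction rule: inc_induct) (auto split: option.splits)

lemma cf_rem_in:
  assumes "fundamental_domain K" "cf_rem K h n = Some x"
  shows "x \<in> K"
  using assms(2)
  by (cases n) (auto intro: hfloor(2)[OF assms(1)] split: option.splits if_splits)

lemma CF_in:
  assumes "fundamental_domain K" "CF K h n = Some g"
  shows "g \<in> heisZ"
  using assms(2)
  by (cases n) (auto intro: hfloor(1)[OF assms(1)] split: option.splits if_splits)

lemma approximant_error:
  assumes K: "fundamental_domain K" "rad K < 1" and n: "CF K h n \<noteq> None"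
  shows "q_denom (CF K h) n \<noteq> 0" "1 \<le> cmod (q_denom (CF K h) n)"
    and "hdist (approximant (CF K h) n) h * sqrt (cmod (q_denom (CF K h) n))
      = (\<Prod>j=0..n. hnorm (the (cf_rem K h j)))"
proof -
  from rad_real[OF K] obtain r where r: "r < 1" "\<And>k. k \<in> K \<Longrightarrow> hnorm k \<le> r"
    by metis
  define x where "x j = the (cf_rem K h j)" for j
  \<comment> \<open>Padding with the identity beyond n keeps every \<open>g j\<close> in
    \<open>heisZ\<close>.\<close>
  define g where "g j = (if j \<le> n then the (CF K h j) else hone)" for j
  let ?gs = "map g [Suc 0..<Suc n]"
  have def: "cf_rem K h j = Some (x j)" "CF K h j = Some (g j)" if "j \<le> n" for j
    using CF_not_None_antimono[OF n that] that CF_eq_None_iff[of K h j] by (auto simp: x_def g_def)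
  have digits: "g j \<in> heisZ" for j
    using CF_in[OF K(1) def(2)] by (cases "j \<le> n") (auto simp: g_def hone_def heisZ_def)
  have small: "hnorm (x j) < 1" if "j \<le> n" for j
    using r(1) r(2)[OF cf_rem_in[OF K(1) def(1)[OF that]]] by simp
  \<comment> \<open>A digit with index j+1 exists only if the expansion did not stop at
    \<open>x j\<close>.\<close>
  have nonzero: "x j \<noteq> hone" and rem: "hmul (hinv (g (Suc j))) (koranyi (x j)) = x (Suc j)"
    if "j < n" for j
    using def[of j] def[of "Suc j"] that by (auto split: if_splits)
  have step: "koranyi (x j) = hmul (g (Suc j)) (x (Suc j))" if "j < n" for j
    using rem[OF that] by (metis hmul_hinv_cancel(1))
  have gs: "map (\<lambda>i. the (CF K h i)) [1..<Suc n] = ?gs"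
    by (auto simp: g_def)
  have q: "q_denom (CF K h) n = cf_vec ?gs $ 1"
    unfolding q_denom_def qrp_def gs foldr_A_mat ..
  have "approximant (CF K h) n = cfrac (g 0 # ?gs)"
    unfolding approximant_def gs[symmetric] by (subst upt_conv_Cons) (auto simp: g_def)
  then have a: "approximant (CF K h) n = hmul (g 0) (inv_cfrac ?gs)"
    by (simp only: cfrac_Cons)
  have "hmul (hinv (g 0)) h = x 0"
    using def[of 0] by auto
  then have "h = hmul (g 0) (x 0)"
    by (metis hmul_hinv_cancel(1))
  \<comment> \<open>Digit 0 is a left translation of both points, hence cancels from the
    distance.\<close>
  with a have d: "hdist (approximant (CF K h) n) h = hdist (inv_cfrac ?gs) (x 0)"
    by simp
  have *: "represents (cf_vec ?gs) (inv_cfrac ?gs)"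
    "hdist (inv_cfrac ?gs) (x 0) * sqrt (cmod (cf_vec ?gs $ 1)) = (\<Prod>j=0..n. hnorm (x j))"
    using inv_cfrac_error[where i = 0 and n = n and g = g and x = x, OF le0 digits small nonzero step]
    by blast+
  show nz: "q_denom (CF K h) n \<noteq> 0"
    using *(1) by (simp add: q represents_def)
  have "set ?gs \<subseteq> heisZ"
    using digits by auto
  then show "1 \<le> cmod (q_denom (CF K h) n)"
    using nz cf_vec_gaussian_ints(1) unfolding q by (intro gaussian_ints_cmod_ge_1)
  show "hdist (approximant (CF K h) n) h * sqrt (cmod (q_denom (CF K h) n))
      = (\<Prod>j=0..n. hnorm (the (cf_rem K h j)))"
    using *(2) unfolding d q x_def .
qed

theorem theorem3p21:
  fixes h :: heis and K :: "heis set"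
  assumes "fundamental_domain K"
    and "rad K < 1"
  shows "has_cf_value (CF K h) h
    \<and> (\<forall>n. CF K h n \<noteq> None \<longrightarrow>
         ereal (hdist (approximant (CF K h) n) h) \<le> rad K ^ (n + 1))
    \<and> (\<forall>n. CF K h n \<noteq> None \<longrightarrow>
         q_denom (CF K h) n \<noteq> 0 \<and>
         ereal (hdist (approximant (CF K h) n) h)
           \<le> rad K ^ (n + 1) / ereal (cmod (q_denom (CF K h) n) powr (1 / 2)))"
proof -
  from rad_real[OF assms] obtain r
    where r: "rad K = ereal r" "0 \<le> r" "r < 1" "\<And>k. k \<in> K \<Longrightarrow> hnorm k \<le> r"
    by blast
  let ?d = "\<lambda>n. hdist (approximant (CF K h) n) h" and ?q = "q_denom (CF K h)"
  have bound: "?d n * sqrt (cmod (?q n)) \<le> r ^ (n + 1)" if "CF K h n \<noteq> None" for n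
  proof -
    have "hnorm (the (cf_rem K h j)) \<le> r" if "j \<le> n" for j
      using CF_not_None_antimono[OF \<open>CF K h n \<noteq> None\<close> that] cf_rem_in[OF assms(1)] r(4)
      by (auto simp: CF_eq_None_iff)
    then have "(\<Prod>j=0..n. hnorm (the (cf_rem K h j))) \<le> (\<Prod>j=0..n. r)"
      by (intro prod_mono) auto
    then show ?thesis
      using approximant_error(3)[OF assms that] by simp
  qed
  have bound': "?d n \<le> r ^ (n + 1)" if "CF K h n \<noteq> None" for n
  proof -
    \<comment> \<open>The bound without the denominator follows because |q| is at least 1.\<close>
    have "?d n \<le> ?d n * sqrt (cmod (?q n))"
      using approximant_error(2)[OF assms that]
        mult_left_mono[of 1 "sqrt (cmod (?q n))" "?d n"] by simp
    with bound[OF that] show ?thesis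
      by linarith
  qed
  have "has_cf_value (CF K h) h"
  proof (cases "\<forall>n. CF K h n \<noteq> None")
    case True
    have "(\<lambda>n. r ^ (n + 1)) \<longlonglongrightarrow> 0"
      using r by (intro LIMSEQ_ignore_initial_segment LIMSEQ_realpow_zero) auto
    then have "?d \<longlonglongrightarrow> 0"
      by (rule tendsto_sandwich[OF _ _ tendsto_const, rotated 2]) (use bound' True in auto)
    with True show ?thesis
      by (simp add: has_cf_value_def)
  next
    case False
    define m where "m = (LEAST n. CF K h n = None)"
    have m: "CF K h m = None"
      using False unfolding m_def by (metis (mono_tags, lifting) LeastI)
    then obtain n where n: "m = Suc n"
      by (cases m) auto
    have some: "CF K h i \<noteq> None" if "i \<le> n" for i
      using not_less_Least[of i "\<lambda>n. CF K h n = None"] that n by (simp add: m_def)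
    have "cf_rem K h n = Some hone"
      \<comment> \<open>The expansion stops after digit n exactly because its remainder is the
        identity. The product in the error formula then vanishes, and q being nonzero forces
        distance 0.\<close>
      using m some[of n] by (auto simp: n CF_eq_None_iff split: option.splits if_splits)
    then have "(\<Prod>j=0..n. hnorm (the (cf_rem K h j))) = 0"
      by (intro prod_zero bexI[of _ n]) auto
    then have "?d n * sqrt (cmod (?q n)) = 0"
      using approximant_error(3)[OF assms some[of n]] by simp
    then have "approximant (CF K h) n = h"
      using approximant_error(1)[OF assms some[of n]] by simp
    then have "\<exists>n. (\<forall>i\<le>n. CF K h i \<noteq> None) \<and> CF K h (Suc n) = None \<and> approximant (CF K h) n = h"
      using m some n by blast
    with False show ?thesis
      unfolding has_cf_value_def by (simp only: if_False)
  qed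
  moreover have "ereal (?d n) \<le> rad K ^ (n + 1) / ereal (cmod (?q n) powr (1 / 2))"
    if "CF K h n \<noteq> None" for n
    using bound[OF that] approximant_error(1)[OF assms that]
    by (simp add: r(1) powr_half_sqrt pos_le_divide_eq)
  ultimately show ?thesis
    using bound' approximant_error(1)[OF assms] r(1) by simp
qed

end
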